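(* Let $d\ge 1$ and let $\mathbf{s}=(s_1,\ldots,s_d)$ be a sequence of positive integers such that $s_1=\cdots=s_i$ for some $1\le i\le d$, and $s_j<s_{j+1}$ for all $i\le j\le d-1$. Let $k\in\mathbb{Z}_{>0}$. Then $\mathbf{P}_d^{(\mathbf{s})}$ is Gorenstein of index $k$ if and only if there exists a sequence $\mathbf{t}=(t_1,\ldots,t_d)$ such that $t_j=ks_j$ for all $1\le j\le d$ (which implies that $t_1=\cdots=t_i$ and $t_j<t_{j+1}$ for $i\le j\le d-1$) and $\mathbf{P}_d^{(\mathbf{t})}$ is reflexive up to translation.
   Context: For a sequence of positive integers $\mathbf{s}=(s_1,\ldots,s_d)$, the $\mathbf{s}$-lecture hall polytope is $\mathbf{P}_d^{(\mathbf{s})}=\{\mathbf{x}\in\mathbb{R}^d : 0\le \frac{x_1}{s_1}\le\frac{x_2}{s_2}\le\cdots\le\frac{x_d}{s_d}\le 1\}$, a $d$-dimensional lattice polytope. A $d$-dimensional lattice polytope $\mathcal{P}\subset\mathbb{R}^d$ is Fano if $(\mathcal{P}\setminus\partial\mathcal{P})\cap\mathbb{Z}^d=\{\mathbf{0}\}$. It is reflexive if it is Fano and its dual polytope $\mathcal{P}^\vee=\{y\in\mathbb{R}^d : \langle x,y\rangle\le 1 \text{ for all } x\in\mathcal{P}\}$ is a lattice polytope. "Reflexive up to translation" means that some translate by a vector in $\mathbb{Z}^d$ is reflexive. Two $d$-dimensional lattice polytopes $\mathcal{P},\mathcal{Q}\subset\mathbb{R}^d$ are unimodularly equivalent if $\mathcal{Q}=f_U(\mathcal{P})+\mathbf{w}$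 for some $U\in\mathbb{Z}^{d\times d}$ with $\det U=\pm1$ and some $\mathbf{w}\in\mathbb{Z}^d$, where $f_U(\mathbf{v})=\mathbf{v}U$. For $c\in\mathbb{Z}_{>0}$, $\mathcal{P}$ is Gorenstein of index $c$ if $c\mathcal{P}=\{c\alpha:\alpha\in\mathcal{P}\}$ is unimodularly equivalent to a reflexive polytope. *)

theory Defs
  imports "HOL-Analysis.Analysis"
begin

text \<open>
  The space \<open>\<real>\<^sup>d\<close> is \<open>real ^ 'n\<close> with \<open>d = CARD('n)\<close>. Sequences and coordinates are
  numbered \<open>1, \<dots>, d\<close>; \<open>idx j\<close> is the \<open>j\<close>-th smallest element of the linearly ordered
  index type and is meaningful only for \<open>1 \<le> j \<le> d\<close>.
\<close>

definition idx :: "nat \<Rightarrow> 'n::{finite,linorder}" where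
  "idx j = sorted_list_of_set (UNIV :: 'n set) ! (j - 1)"

lemma bij_betw_idx: "bij_betw (idx :: nat \<Rightarrow> 'n::{finite,linorder}) {1..CARD('n)} UNIV"
proof -
  let ?l = "sorted_list_of_set (UNIV :: 'n set)"
  have "bij_betw (\<lambda>j. j - 1) {1..CARD('n)} {..<CARD('n)}"
    by (rule bij_betw_byWitness[where f' = Suc]) auto
  moreover have "bij_betw ((!) ?l) {..<CARD('n)} UNIV"
    by (rule bij_betw_nth) auto
  ultimately have "bij_betw ((!) ?l \<circ> (\<lambda>j. j - 1)) {1..CARD('n)} UNIV"
    by (rule bij_betw_trans)
  then show ?thesis
    by (simp add: idx_def[abs_def] comp_def)
qed

definition lecture_hall_polytope :: "(nat \<Rightarrow> nat) \<Rightarrow> (real ^ 'n::{finite,linorder}) set" where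
  "lecture_hall_polytope s =
    {x. 0 \<le> x $ idx 1 / real (s 1) \<and>
        (\<forall>j\<in>{1..<CARD('n)}.
           x $ idx j / real (s j) \<le> x $ idx (j + 1) / real (s (j + 1))) \<and>
        x $ idx CARD('n) / real (s CARD('n)) \<le> 1}"

definition integer_points :: "(real ^ 'n) set" where
  "integer_points = {x. \<forall>i. x $ i \<in> \<int>}"

definition lattice_polytope :: "(real ^ 'n) set \<Rightarrow> bool" where
  "lattice_polytope P \<longleftrightarrow> (\<exists>V. finite V \<and> V \<subseteq> integer_points \<and> P = convex hull V)"

definition full_lattice_polytope :: "(real ^ 'n) set \<Rightarrow> bool" where
  "full_lattice_polytope P \<longleftrightarrow> lattice_polytope P \<and> aff_dim P = int CARD('n)"

definition fano :: "(real ^ 'n) set \<Rightarrow> bool" where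
  "fano P \<longleftrightarrow> full_lattice_polytope P \<and> (P - frontier P) \<inter> integer_points = {0}"

definition dual_polytope :: "(real ^ 'n) set \<Rightarrow> (real ^ 'n) set" where
  "dual_polytope P = {y. \<forall>x\<in>P. x \<bullet> y \<le> 1}"

definition reflexive :: "(real ^ 'n) set \<Rightarrow> bool" where
  "reflexive P \<longleftrightarrow> fano P \<and> lattice_polytope (dual_polytope P)"

definition reflexive_up_to_translation :: "(real ^ 'n) set \<Rightarrow> bool" where
  "reflexive_up_to_translation P \<longleftrightarrow> (\<exists>w\<in>integer_points. reflexive ((\<lambda>x. x + w) ` P))"

definition unimod_map :: "int ^ 'n ^ 'n \<Rightarrow> real ^ 'n \<Rightarrow> real ^ 'n" where
  "unimod_map U v = v v* (\<chi> i j. real_of_int (U $ i $ j))"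

definition unimodularly_equivalent :: "(real ^ 'n) set \<Rightarrow> (real ^ 'n) set \<Rightarrow> bool" where
  "unimodularly_equivalent P Q \<longleftrightarrow>
    full_lattice_polytope P \<and> full_lattice_polytope Q \<and>
    (\<exists>U w. (det U = 1 \<or> det U = -1) \<and> w \<in> integer_points \<and>
           Q = (\<lambda>x. unimod_map U x + w) ` P)"

definition gorenstein_of_index :: "nat \<Rightarrow> (real ^ 'n) set \<Rightarrow> bool" where
  "gorenstein_of_index c P \<longleftrightarrow>
    c > 0 \<and> full_lattice_polytope P \<and>
    (\<exists>Q. reflexive Q \<and> unimodularly_equivalent ((\<lambda>x. real c *\<^sub>R x) ` P) Q)"

end

(* Since k P(s) = P(k s), Gorensteinness of index k asks for P(k s) to be unimodularly equivalent to
   a reflexive polytope Q. Undoing the linear part U of the equivalence turns Q into an integer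
   translate of P(k s), and a lattice-preserving linear bijection f keeps reflexivity because the
   dual of P is the image of the dual of f P under the adjoint of f, which is again
   lattice-preserving. Conversely, P(s) is the convex hull of the truncations
   (0, ..., 0, s_j, ..., s_d), hence a lattice polytope. *)
theory Submission
  imports Defs
begin

section \<open>Lattice-preserving linear bijections\<close>

text \<open>Convex hulls commute with linear maps. To pull back from the image, lift its integer
  generators through \<open>f\<close> to integer points and cancel \<open>f\<close> by
  injectivity.\<close>

lemma linear_image_lattice_polytope_iff:
  fixes f :: "real ^ 'n \<Rightarrow> real ^ 'n"
  assumes "linear f" "inj f" "f ` integer_points = integer_points"
  shows "lattice_polytope (f ` P) \<longleftrightarrow> lattice_polytope P"
proof
  assume "lattice_polytope (f ` P)"
  then obtain V where V: "finite V" "V \<subseteq> integer_points" "f ` P = convex hull V"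
    by (auto simp: lattice_polytope_def)
  then obtain W where W: "W \<subseteq> integer_points" "finite W" "V = f ` W"
    using assms(3) finite_subset_image[of V f integer_points] by auto
  have "f ` P = f ` (convex hull W)"
    using V W assms(1) by (simp add: convex_hull_linear_image)
  then have "P = convex hull W"
    using assms(2) by (simp add: inj_image_eq_iff)
  with W show "lattice_polytope P"
    by (auto simp: lattice_polytope_def)
next
  assume "lattice_polytope P"
  then obtain V where "finite V" "V \<subseteq> integer_points" "P = convex hull V"
    by (auto simp: lattice_polytope_def)
  then show "lattice_polytope (f ` P)"
    unfolding lattice_polytope_def using assms(1,3)
    by (intro exI[of _ "f ` V"]) (auto simp: convex_hull_linear_image)
qed

lemma diff_frontier: "S - frontier S = interior S"
  using closure_subset interior_subset by (fastforce simp: frontier_def)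

text \<open>An injective linear endomorphism in finite dimension is open, so \<open>f\<close>
  commutes with taking interiors; it also fixes the origin and maps the lattice onto itself.\<close>

lemma fano_linear_imageD:
  fixes f :: "real ^ 'n \<Rightarrow> real ^ 'n"
  assumes "linear f" "inj f" "f ` integer_points = integer_points" "fano (f ` P)"
  shows "fano P"
proof -
  have "interior (f ` P) = f ` interior P"
    using assms by (simp add: interior_injective_linear_image)
  then have "f ` (interior P \<inter> integer_points) = f ` {0}"
    using assms by (simp add: fano_def diff_frontier image_Int linear_0)
  then have "interior P \<inter> integer_points = {0}"
    using assms(2) by (simp only: inj_image_eq_iff)
  then show ?thesis
    using assms
    by (simp add: fano_def diff_frontier full_lattice_polytope_def
        linear_image_lattice_polytope_iff aff_dim_injective_linear_image)
qed

text \<open>By adjointness, \<open>y\<close> lies in the dual of the image exactly when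
  \<open>g y\<close> lies in the dual of \<open>P\<close>; surjectivity of \<open>g\<close> then
  reaches every point of the latter.\<close>

lemma dual_polytope_linear_image:
  fixes f g :: "real ^ 'n \<Rightarrow> real ^ 'n"
  assumes "\<And>x y. f x \<bullet> y = x \<bullet> g y" "surj g"
  shows "dual_polytope P = g ` dual_polytope (f ` P)"
proof
  show "dual_polytope P \<subseteq> g ` dual_polytope (f ` P)"
  proof
    fix z assume "z \<in> dual_polytope P"
    moreover obtain y where "z = g y"
      using assms(2) by blast
    ultimately show "z \<in> g ` dual_polytope (f ` P)"
      using assms(1) by (auto simp: dual_polytope_def)
  qed
qed (auto simp: dual_polytope_def assms(1))

text \<open>The Fano property is pulled back along \<open>f\<close>, while the lattice property of
  the dual is pushed forward along the adjoint \<open>g\<close>; hence both maps are asked to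
  preserve the lattice.\<close>

lemma reflexive_linear_imageD:
  fixes f g :: "real ^ 'n \<Rightarrow> real ^ 'n"
  assumes "linear f" "inj f" "f ` integer_points = integer_points"
    and "linear g" "inj g" "g ` integer_points = integer_points"
    and "\<And>x y. f x \<bullet> y = x \<bullet> g y" "reflexive (f ` P)"
  shows "reflexive P"
proof -
  have "dual_polytope P = g ` dual_polytope (f ` P)"
    using assms by (intro dual_polytope_linear_image linear_injective_imp_surjective) auto
  then show ?thesis
    using assms fano_linear_imageD[of f P]
    by (simp add: reflexive_def linear_image_lattice_polytope_iff)
qed

section \<open>Unimodular matrices\<close>

lemma det_Ints:
  fixes A :: "real ^ 'n ^ 'n"
  assumes "\<And>i j. A $ i $ j \<in> \<int>"
  shows "det A \<in> \<int>"
  unfolding det_def using assms by (intro Ints_sum Ints_mult Ints_prod) auto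

text \<open>Surjectivity on the lattice is Cramer's rule: the solution's coordinates are integer
  determinants divided by a determinant equal to 1 or -1.\<close>

lemma unimodular_matrix_image_integer_points:
  fixes A :: "real ^ 'n ^ 'n"
  assumes int: "\<And>i j. A $ i $ j \<in> \<int>" and det: "\<bar>det A\<bar> = 1"
  shows "(*v) A ` integer_points = integer_points"
proof
  show "(*v) A ` integer_points \<subseteq> integer_points"
    using int by (auto simp: integer_points_def matrix_vector_mult_def intro!: Ints_sum Ints_mult)
  show "integer_points \<subseteq> (*v) A ` integer_points"
  proof
    fix b :: "real ^ 'n" assume b: "b \<in> integer_points"
    define x where "x = (\<chi> k. det (\<chi> i j. if j = k then b $ i else A $ i $ j) / det A)"
    have "A *v x = b"
      using cramer[of A x b] det by (auto simp: x_def)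
    moreover have "x \<in> integer_points"
    proof -
      have "det (\<chi> i j. if j = k then b $ i else A $ i $ j) \<in> \<int>" for k
        using b int by (intro det_Ints) (auto simp: integer_points_def)
      moreover have "det A = 1 \<or> det A = -1"
        using det by linarith
      ultimately show ?thesis
        by (auto simp: x_def integer_points_def)
    qed
    ultimately show "b \<in> (*v) A ` integer_points"
      by blast
  qed
qed

lemma det_of_int:
  "det (\<chi> i j. real_of_int (U $ i $ j)) = real_of_int (det (U :: int ^ 'n ^ 'n))"
  by (simp add: det_def)

text \<open>The shift is moved inside the linear part: with \<open>w = B *v v\<close> for an integer
  \<open>v\<close>, \<open>Q\<close> is the \<open>B\<close>-image of the translate of
  \<open>P\<close> by \<open>v\<close>, and reflexivity pulls back along \<open>B\<close>.\<close>

lemma reflexive_up_to_translation_if_unimodularly_equivalent: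
  assumes "unimodularly_equivalent P Q" "reflexive Q"
  shows "reflexive_up_to_translation P"
proof -
  obtain U w where U: "det U = 1 \<or> det U = -1" and w: "w \<in> integer_points"
    and Q: "Q = (\<lambda>x. unimod_map U x + w) ` P"
    using assms(1) by (auto simp: unimodularly_equivalent_def)
  define A where "A = (\<chi> i j. real_of_int (U $ i $ j))"
  \<comment> \<open>\<open>unimod_map\<close> multiplies row vectors from the right, so on column
    vectors it acts by the transpose \<open>B\<close>, whose adjoint is \<open>A\<close>.\<close>
  define B where "B = transpose A"
  have det: "\<bar>det A\<bar> = 1" "\<bar>det B\<bar> = 1"
    using U by (auto simp: A_def B_def det_of_int)
  have "A $ i $ j \<in> \<int>" "B $ i $ j \<in> \<int>" for i j
    by (auto simp: A_def B_def transpose_def)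
  then have int: "(*v) A ` integer_points = integer_points" "(*v) B ` integer_points = integer_points"
    using det by (auto intro!: unimodular_matrix_image_integer_points)
  have "invertible A" "invertible B"
    using det by (auto simp: invertible_det_nz)
  then have inj: "inj ((*v) A)" "inj ((*v) B)"
    by (auto intro: inj_matrix_vector_mult)
  obtain v where v: "v \<in> integer_points" "w = B *v v"
    using w int(2) by blast
  have "unimod_map U = (*v) B"
    by (rule ext) (simp add: unimod_map_def A_def B_def)
  then have "Q = (*v) B ` (\<lambda>x. x + v) ` P"
    by (simp only: Q image_image v(2) matrix_vector_right_distrib)
  moreover have "(B *v x) \<bullet> y = x \<bullet> (A *v y)" for x y
    by (simp add: B_def dot_lmul_matrix)
  ultimately have "reflexive ((\<lambda>x. x + v) ` P)"
    using reflexive_linear_imageD[OF matrix_vector_mul_linear inj(2) int(2)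
        matrix_vector_mul_linear inj(1) int(1)] assms(2)
    by blast
  with v(1) show ?thesis
    by (auto simp: reflexive_up_to_translation_def)
qed

section \<open>Integer translations\<close>

lemma lattice_polytope_translation:
  assumes "w \<in> integer_points" "lattice_polytope P"
  shows "lattice_polytope ((\<lambda>x. x + w) ` P)"
proof -
  obtain V where "finite V" "V \<subseteq> integer_points" "P = convex hull V"
    using assms(2) by (auto simp: lattice_polytope_def)
  moreover have "(\<lambda>x. x + w) = (+) w"
    by (auto simp: add.commute)
  ultimately show ?thesis
    unfolding lattice_polytope_def using assms(1)
    by (intro exI[of _ "(+) w ` V"])
      (auto simp: convex_hull_translation integer_points_def subset_iff)
qed

lemma full_lattice_polytope_translation_iff:
  assumes "w \<in> integer_points"
  shows "full_lattice_polytope ((\<lambda>x. x + w) ` P) \<longleftrightarrow> full_lattice_polytope P"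
proof -
  have "- w \<in> integer_points"
    using assms by (simp add: integer_points_def)
  then have "lattice_polytope ((\<lambda>x. x + w) ` P) \<longleftrightarrow> lattice_polytope P"
    \<comment> \<open>Shifting back by \<open>- w\<close> gives the converse.\<close>
    using lattice_polytope_translation[of "- w" "(\<lambda>x. x + w) ` P"]
      lattice_polytope_translation[OF assms]
    by (auto simp: image_image)
  moreover have "aff_dim ((\<lambda>x. x + w) ` P) = aff_dim P"
    using aff_dim_translation_eq[of w P] by (simp add: add.commute)
  ultimately show ?thesis
    by (simp add: full_lattice_polytope_def)
qed

lemma unimodularly_equivalent_translation:
  assumes "w \<in> integer_points" "full_lattice_polytope P"
  shows "unimodularly_equivalent P ((\<lambda>x. x + w) ` P)"
proof -
  have "(\<chi> i j. real_of_int ((mat 1 :: int ^ 'a ^ 'a) $ i $ j)) = mat 1"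
    by (simp add: mat_def vec_eq_iff)
  then have "unimod_map (mat 1) = (\<lambda>v :: real ^ 'a. v)"
    by (auto simp: unimod_map_def)
  then show ?thesis
    unfolding unimodularly_equivalent_def
    using assms full_lattice_polytope_translation_iff[of w P]
    by (auto intro!: exI[of _ "mat 1"] exI[of _ w])
qed

section \<open>Lecture hall polytopes\<close>

text \<open>Dividing a coordinate by \<open>k * s j\<close> is dividing it by \<open>k\<close> and
  then by \<open>s j\<close>, so the inequalities for \<open>t\<close> at \<open>x\<close> are those
  for \<open>s\<close> at \<open>x / k\<close>.\<close>

lemma lecture_hall_polytope_scale:
  fixes s t :: "nat \<Rightarrow> nat"
  assumes "0 < k" "\<forall>j\<in>{1..CARD('n)}. t j = k * s j"
  shows "lecture_hall_polytope t =
    (\<lambda>x. real k *\<^sub>R x) ` (lecture_hall_polytope s :: (real ^ 'n::{finite,linorder}) set)"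
proof -
  have div: "x / real (t j) = (x / real k) / real (s j)" if "1 \<le> j" "j \<le> CARD('n)" for x j
    using assms(2) that by simp
  have mem: "x \<in> lecture_hall_polytope t \<longleftrightarrow> (1 / real k) *\<^sub>R x \<in> lecture_hall_polytope s"
    for x :: "real ^ 'n::{finite,linorder}"
    unfolding lecture_hall_polytope_def by (simp add: div Suc_leI)
  show ?thesis
  proof (intro equalityI subsetI)
    fix x :: "real ^ 'n::{finite,linorder}" assume "x \<in> lecture_hall_polytope t"
    moreover have "x = real k *\<^sub>R (1 / real k) *\<^sub>R x"
      using assms(1) by simp
    ultimately show "x \<in> (\<lambda>x. real k *\<^sub>R x) ` lecture_hall_polytope s"
      using mem by blast
  qed (use assms(1) in \<open>auto simp: mem\<close>)
qed

lemma convex_lecture_hall_polytope: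
  "convex (lecture_hall_polytope s :: (real ^ 'n::{finite,linorder}) set)"
proof -
  let ?c = "\<lambda>j (x :: real ^ 'n::{finite,linorder}). x $ idx j / real (s j)"
  have lin: "linear (?c j)" for j
    by (intro linearI) (auto simp: add_divide_distrib)
  then have "linear (\<lambda>x. ?c (j + 1) x - ?c j x)" for j
    \<comment> \<open>Each chain inequality becomes nonnegativity of a linear functional, so the
      polytope is an intersection of half-spaces.\<close>
    by (intro linear_compose_sub)
  with lin have "convex (?c 1 -` {0..})" "convex (?c CARD('n) -` {..1})"
    "convex ((\<lambda>x. ?c (j + 1) x - ?c j x) -` {0..})" for j
    by (blast intro: convex_linear_vimage convex_real_interval)+
  moreover have "lecture_hall_polytope s = ?c 1 -` {0..} \<inter> ?c CARD('n) -` {..1} \<inter>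
     (\<Inter>j\<in>{1..<CARD('n)}. (\<lambda>x. ?c (j + 1) x - ?c j x) -` {0..})"
    by (auto simp: lecture_hall_polytope_def)
  ultimately show ?thesis
    by (simp only: convex_Int convex_INT)
qed

text \<open>The ratios \<open>x_j / s_j\<close> increase from 0 to 1; their successive increments
  are the convex coefficients that express \<open>x\<close> through the truncations of
  \<open>s\<close>.\<close>

lemma lattice_polytope_lecture_hall:
  assumes pos: "\<forall>j\<in>{1..CARD('n)}. 0 < s j"
  shows "lattice_polytope (lecture_hall_polytope s :: (real ^ 'n::{finite,linorder}) set)"
proof -
  let ?d = "CARD('n)"
  let ?P = "lecture_hall_polytope s :: (real ^ 'n::{finite,linorder}) set"
  have d: "1 \<le> ?d"
    by (simp add: Suc_leI)
  define rank :: "'n \<Rightarrow> nat" where "rank = inv_into {1..?d} idx"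
  have rank_idx: "rank (idx j) = j" if "j \<in> {1..?d}" for j
    using that bij_betw_idx[where 'n = 'n]
    by (auto simp: rank_def bij_betw_def intro!: inv_into_f_f)
  have vec_eqI: "x = y" if "\<And>j. j \<in> {1..?d} \<Longrightarrow> x $ idx j = y $ idx j" for x y :: "real ^ 'n::{finite,linorder}"
    using that bij_betw_idx[where 'n = 'n] unfolding bij_betw_def vec_eq_iff
    by (metis UNIV_I imageE)
  \<comment> \<open>\<open>v 1\<close> is the full vector of \<open>s\<close>. Ranks never exceed
    \<open>d\<close>, so \<open>v (d + 1)\<close> is the origin, the last of the
    \<open>d + 1\<close> generators.\<close>
  define v :: "nat \<Rightarrow> real ^ 'n::{finite,linorder}" where
    "v j = (\<chi> i. if j \<le> rank i then real (s (rank i)) else 0)" for j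
  have v_idx: "v j $ idx m = (if j \<le> m then real (s m) else 0)" if "m \<in> {1..?d}" for j m
    using that by (simp add: v_def rank_idx)
  have "v j \<in> ?P" for j
    using pos d by (auto simp: lecture_hall_polytope_def v_idx)
  then have "convex hull (v ` {1..?d + 1}) \<subseteq> ?P"
    by (intro hull_minimal convex_lecture_hall_polytope) auto
  moreover have "?P \<subseteq> convex hull (v ` {1..?d + 1})"
  proof
    fix x assume x: "x \<in> ?P"
    \<comment> \<open>The boundary values 0 at index 0 and 1 beyond \<open>d\<close> encode the two
      outer inequalities, making all increments nonnegative with total 1.\<close>
    define y where
      "y j = (if j = 0 then 0 else if j \<le> ?d then x $ idx j / real (s j) else 1)" for j
    have y_mono: "y j \<le> y (Suc j)" for j
      using x d by (auto simp: lecture_hall_polytope_def y_def not_less_eq_eq le_Suc_eq)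
    have y_sum: "(\<Sum>j = 1..m. y j - y (j - 1)) = y m" for m
      by (induction m) (auto simp: y_def)
    have "x = (\<Sum>j = 1..?d + 1. (y j - y (j - 1)) *\<^sub>R v j)"
    proof (rule vec_eqI)
      fix m assume m: "m \<in> {1..?d}"
      have "(\<Sum>j = 1..?d + 1. (y j - y (j - 1)) *\<^sub>R v j) $ idx m
          = (\<Sum>j = 1..?d + 1. if j \<le> m then (y j - y (j - 1)) * real (s m) else 0)"
        using m by (auto simp: v_idx intro!: sum.cong)
      \<comment> \<open>Only truncations starting at or before position \<open>m\<close> contribute
        there, so the remaining sum telescopes.\<close>
      also have "\<dots> = (\<Sum>j = 1..m. (y j - y (j - 1)) * real (s m))"
        using m by (intro sum.mono_neutral_cong_right) auto
      also have "\<dots> = y m * real (s m)"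
        by (simp only: y_sum flip: sum_distrib_right)
      also have "\<dots> = x $ idx m"
        using m pos by (auto simp: y_def)
      finally show "x $ idx m = (\<Sum>j = 1..?d + 1. (y j - y (j - 1)) *\<^sub>R v j) $ idx m" ..
    qed
    also have "\<dots> \<in> convex hull (v ` {1..?d + 1})"
    proof (rule convex_sum)
      show "(\<Sum>j = 1..?d + 1. y j - y (j - 1)) = 1"
        by (simp only: y_sum) (simp add: y_def)
      show "0 \<le> y j - y (j - 1)" if "j \<in> {1..?d + 1}" for j
        using that y_mono[of "j - 1"] by simp
    qed (auto intro: hull_inc)
    finally show "x \<in> convex hull (v ` {1..?d + 1})" .
  qed
  moreover have "v ` {1..?d + 1} \<subseteq> integer_points"
    by (auto simp: integer_points_def v_def)
  ultimately show ?thesis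
    unfolding lattice_polytope_def
    by (intro exI[of _ "v ` {1..?d + 1}"]) auto
qed

theorem corollary2p7:
  fixes s :: "nat \<Rightarrow> nat" and d i k :: nat
  assumes "d = CARD('n::{finite,linorder})"
    and "\<forall>j\<in>{1..d}. 0 < s j"
    and "1 \<le> i" and "i \<le> d"
    and "\<forall>j\<in>{1..i}. s j = s 1"
    and "\<forall>j. i \<le> j \<and> j < d \<longrightarrow> s j < s (j + 1)"
    and "0 < k"
  shows "(gorenstein_of_index k (lecture_hall_polytope s :: (real ^ 'n::{finite,linorder}) set) \<longleftrightarrow>
           (\<exists>t :: nat \<Rightarrow> nat. (\<forall>j\<in>{1..d}. t j = k * s j) \<and>
              reflexive_up_to_translation (lecture_hall_polytope t :: (real ^ 'n::{finite,linorder}) set))) \<and>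
         (\<forall>t :: nat \<Rightarrow> nat. (\<forall>j\<in>{1..d}. t j = k * s j) \<longrightarrow>
            (\<forall>j\<in>{1..i}. t j = t 1) \<and>
            (\<forall>j. i \<le> j \<and> j < d \<longrightarrow> t j < t (j + 1)))"
proof (intro conjI iffI allI impI ballI)
  let ?P = "\<lambda>s. lecture_hall_polytope s :: (real ^ 'n::{finite,linorder}) set"
  note d = assms(1) and k = assms(7)
  have scale: "?P t = (\<lambda>x. real k *\<^sub>R x) ` ?P s" if "\<forall>j\<in>{1..d}. t j = k * s j" for t
    using that d k by (intro lecture_hall_polytope_scale) auto
  {
    assume "gorenstein_of_index k (?P s)"
    then have "reflexive_up_to_translation ((\<lambda>x. real k *\<^sub>R x) ` ?P s)"
      by (auto simp: gorenstein_of_index_def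
          intro: reflexive_up_to_translation_if_unimodularly_equivalent)
    then show "\<exists>t. (\<forall>j\<in>{1..d}. t j = k * s j) \<and> reflexive_up_to_translation (?P t)"
      by (intro exI[of _ "\<lambda>j. k * s j"]) (simp add: scale)
  }
  {
    assume "\<exists>t. (\<forall>j\<in>{1..d}. t j = k * s j) \<and> reflexive_up_to_translation (?P t)"
    then obtain t w where t: "\<forall>j\<in>{1..d}. t j = k * s j"
      and w: "w \<in> integer_points" "reflexive ((\<lambda>x. x + w) ` ?P t)"
      by (auto simp: reflexive_up_to_translation_def)
    have full: "full_lattice_polytope (?P t)"
      using w full_lattice_polytope_translation_iff[of w "?P t"]
      by (auto simp: reflexive_def fano_def)
    \<comment> \<open>Being Gorenstein requires the undilated polytope to be full-dimensional; its
      dimension is read off from the dilate, as scaling by \<open>k > 0\<close> is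
      injective.\<close>
    have "aff_dim (?P t) = aff_dim (?P s)"
      unfolding scale[OF t] using k
      by (intro aff_dim_injective_linear_image) (simp_all add: inj_def linear_scaleR)
    then have "full_lattice_polytope (?P s)"
      using full lattice_polytope_lecture_hall[of s] assms(2) d
      by (auto simp: full_lattice_polytope_def)
    moreover have "unimodularly_equivalent (?P t) ((\<lambda>x. x + w) ` ?P t)"
      using w(1) full by (rule unimodularly_equivalent_translation)
    ultimately show "gorenstein_of_index k (?P s)"
      using w(2) k unfolding scale[OF t] gorenstein_of_index_def by blast
  }
  {
    fix t j assume t: "\<forall>j\<in>{1..d}. t j = k * s j" and j: "j \<in> {1..i}"
    have "t j = k * s j" "t 1 = k * s 1"
      using t j assms(3,4) by simp_all
    moreover have "s j = s 1"
      using assms(5) j by blast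
    ultimately show "t j = t 1"
      by metis
  }
  {
    fix t j assume t: "\<forall>j\<in>{1..d}. t j = k * s j" and j: "i \<le> j \<and> j < d"
    then have "t j = k * s j" "t (j + 1) = k * s (j + 1)"
      using assms(3) by simp_all
    moreover have "s j < s (j + 1)"
      using assms(6) j by blast
    ultimately show "t j < t (j + 1)"
      using k by simp
  }
qed

end
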